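(* Let $a,b,c\in\mathbb R$ with $a\ne0$, and let $J$ be an open interval on which $b+at>0$. Let $f(t,s)=\sum_{n\ge0}s^nf_n(t)$ be a formal power series in $s$ whose coefficients $f_n$ are smooth functions on $J$, and suppose that $f$ satisfies (as an identity of formal power series in $s$) $$-3as f_s-2(b+at)f_t+af=0 .$$ Then for every $n\ge0$ there is a constant $C_n$ with $f_n(t)=C_n(b+at)^{(1-3n)/2}$ on $J$. If $f$ in addition satisfies $$c+a-2af f_t+3(b+at)f_s+4asf_{tt}-8as(f_t)^3+12asf_tf_s=0 ,$$ then $$C_1=\frac{a^2C_0^2-a-c}{3},$$ so that $$f(t,s)=C_0\sqrt{b+at}+\frac{a^2C_0^2-a-c}{3(b+at)}\,s+O(s^2),\qquad f_s(t,0)=\frac{a^2C_0^2-a-c}{3(b+at)} .$$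
   Context: The two equations are the Heat--Airy boundary compatibility equations for the operator $bD^2+axD+c$ ($D=\partial/\partial x$), arising from $N_2v=0$ and $D(N_2v)=0$ on an absorbing boundary $x=f(t,s)$, where $N_2=c+axD+(b+at)D^2-asD^3$. Subscripts $t,s$ denote (termwise) partial derivatives, and $O(s^2)$ means equality modulo $s^2$ as formal power series. *)

theory Defs
  imports "HOL-Analysis.Analysis"
begin

text \<open>
  A formal power series \<open>f(t,s) = (\<Sum>n. s^n f_n(t))\<close> in \<open>s\<close> with real-valued coefficient
  functions is represented as a map \<open>f :: real \<Rightarrow> real fps\<close>, with \<open>f_n t = fps_nth (f t) n\<close>.
  Then \<open>s\<close> is \<open>fps_X\<close> and \<open>f_s\<close> at \<open>t\<close> is \<open>fps_deriv (f t)\<close>.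
\<close>

definition smooth_fun_on :: "real set \<Rightarrow> (real \<Rightarrow> real) \<Rightarrow> bool" where
  "smooth_fun_on J g \<longleftrightarrow> (\<forall>k. \<forall>t\<in>J. ((deriv ^^ k) g) differentiable (at t))"
  \<comment> \<open>intended for open \<open>J\<close>: the derivatives are taken in the ambient real line\<close>

definition fps_dt :: "(real \<Rightarrow> real fps) \<Rightarrow> real \<Rightarrow> real fps" where
  "fps_dt f t = Abs_fps (\<lambda>n. deriv (\<lambda>u. fps_nth (f u) n) t)"

definition fps_ds :: "(real \<Rightarrow> real fps) \<Rightarrow> real \<Rightarrow> real fps" where
  "fps_ds f t = fps_deriv (f t)"

end

(* Comparing coefficients of s^n turns the first equation into the scalar linear ODE
   (b + at) f_n' = (a (1 - 3n) / 2) f_n, whose solutions are the multiples of (b + at)^((1 - 3n)/2).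
   In the second equation only the terms without a factor s reach the coefficient of s^0:
   c + a - 2 a f_0 f_0' + 3 (b + at) f_1 = 0, and 2 a f_0 f_0' is the constant a^2 C_0^2. *)
theory Submission
  imports Defs
begin

text \<open>The quotient is the series shifted down by \<open>n\<close> places. With
  \<open>n = 2\<close> this reduces an equality modulo s^2 to a check of two coefficients.\<close>

lemma fps_X_power_dvd:
  fixes F :: "'a::comm_ring_1 fps"
  assumes "\<And>i. i < n \<Longrightarrow> fps_nth F i = 0"
  shows "fps_X ^ n dvd F"
proof
  show "F = fps_X ^ n * fps_shift n F"
    using assms by (auto simp: fps_eq_iff fps_X_power_mult_nth)
qed

lemma has_real_derivative_affine_powr:
  fixes a b k t :: real
  assumes "b + a * t > 0"
  shows "((\<lambda>u. (b + a * u) powr k) has_real_derivative k * a * (b + a * t) powr (k - 1)) (at t)"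
  using assms by (auto intro!: derivative_eq_intros)

text \<open>Integrating factor: multiplying \<open>g\<close> by
  \<open>(b + a * t) powr (- k)\<close> gives a function with zero derivative, hence a constant on
  the convex set \<open>J\<close>. Positivity of \<open>b + a * t\<close> allows the factor to be
  inverted.\<close>

lemma euler_ode_solution:
  fixes a b k :: real and g :: "real \<Rightarrow> real"
  assumes "convex J"
    and pos: "\<And>t. t \<in> J \<Longrightarrow> b + a * t > 0"
    and diff: "\<And>t. t \<in> J \<Longrightarrow> g differentiable (at t)"
    and ode: "\<And>t. t \<in> J \<Longrightarrow> (b + a * t) * deriv g t = k * a * g t"
  shows "\<exists>C. \<forall>t\<in>J. g t = C * (b + a * t) powr k"
proof -
  have "((\<lambda>u. g u * (b + a * u) powr (- k)) has_real_derivative 0) (at t within J)"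
    if t: "t \<in> J" for t
  proof -
    have w: "b + a * t > 0" using pos t .
    have g: "(g has_real_derivative deriv g t) (at t)"
      using diff[OF t] DERIV_deriv_iff_real_differentiable by blast
    have "((\<lambda>u. g u * (b + a * u) powr (- k)) has_real_derivative
        deriv g t * (b + a * t) powr (- k) + (- k * a * (b + a * t) powr (- k - 1)) * g t) (at t)"
      by (rule DERIV_mult[OF g has_real_derivative_affine_powr[OF w]])
    \<comment> \<open>Splitting off one factor \<open>b + a * t\<close> gives both terms of the
      product rule the same power, so that the difference of the two sides of the ODE factors
      out.\<close>
    moreover have "(b + a * t) powr (- k) = (b + a * t) * (b + a * t) powr (- k - 1)"
      using w by (simp add: powr_diff)
    hence "deriv g t * (b + a * t) powr (- k) + (- k * a * (b + a * t) powr (- k - 1)) * g t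
        = ((b + a * t) * deriv g t - k * a * g t) * (b + a * t) powr (- k - 1)"
      by (simp add: algebra_simps)
    ultimately show ?thesis
      using ode[OF t] by (simp add: has_field_derivative_at_within)
  qed
  hence "\<exists>C. \<forall>t\<in>J. g t * (b + a * t) powr (- k) = C"
    by (rule has_field_derivative_zero_constant[OF \<open>convex J\<close>])
  then obtain C where C: "\<forall>t\<in>J. g t * (b + a * t) powr (- k) = C" ..
  have "g t = C * (b + a * t) powr k" if "t \<in> J" for t
    using C that pos[OF that] by (auto simp: powr_minus field_simps)
  hence "\<forall>t\<in>J. g t = C * (b + a * t) powr k" ..
  thus ?thesis ..
qed

theorem mainTheorem6:
  fixes a b c :: real and J :: "real set" and f :: "real \<Rightarrow> real fps"
  assumes a_nz: "a \<noteq> 0"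
    and J: "open J" "is_interval J" "J \<noteq> {}"
    and pos: "\<And>t. t \<in> J \<Longrightarrow> b + a * t > 0"
    and smooth: "\<And>n. smooth_fun_on J (\<lambda>t. fps_nth (f t) n)"
    and eq1: "\<And>t. t \<in> J \<Longrightarrow>
      - 3 * fps_const a * fps_X * fps_ds f t - 2 * fps_const (b + a * t) * fps_dt f t
        + fps_const a * f t = 0"
  shows "(\<exists>C :: nat \<Rightarrow> real. \<forall>n. \<forall>t\<in>J.
            fps_nth (f t) n = C n * (b + a * t) powr ((1 - 3 * real n) / 2))
    \<and> (\<forall>C :: nat \<Rightarrow> real.
          (\<forall>n. \<forall>t\<in>J. fps_nth (f t) n = C n * (b + a * t) powr ((1 - 3 * real n) / 2))
          \<longrightarrow> (\<forall>t\<in>J.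
                fps_const c + fps_const a - 2 * fps_const a * f t * fps_dt f t
                + 3 * fps_const (b + a * t) * fps_ds f t
                + 4 * fps_const a * fps_X * fps_dt (fps_dt f) t
                - 8 * fps_const a * fps_X * (fps_dt f t) ^ 3
                + 12 * fps_const a * fps_X * fps_dt f t * fps_ds f t = 0)
          \<longrightarrow> C 1 = (a\<^sup>2 * (C 0)\<^sup>2 - a - c) / 3
            \<and> (\<forall>t\<in>J.
                  fps_X ^ 2 dvd
                    f t - (fps_const (C 0 * sqrt (b + a * t))
                           + fps_const ((a\<^sup>2 * (C 0)\<^sup>2 - a - c) / (3 * (b + a * t))) * fps_X)
                \<and> fps_nth (fps_ds f t) 0 = (a\<^sup>2 * (C 0)\<^sup>2 - a - c) / (3 * (b + a * t))))"
proof (intro conjI allI impI ballI)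
  have "\<exists>C. \<forall>t\<in>J. fps_nth (f t) n = C * (b + a * t) powr ((1 - 3 * real n) / 2)" for n
  proof (rule euler_ode_solution)
    show "convex J" using J(2) by (rule is_interval_convex)
    show "(\<lambda>u. fps_nth (f u) n) differentiable (at t)" if "t \<in> J" for t
      using smooth[of n] that unfolding smooth_fun_on_def by (metis funpow_0)
    show "(b + a * t) * deriv (\<lambda>u. fps_nth (f u) n) t
        = (1 - 3 * real n) / 2 * a * fps_nth (f t) n" if "t \<in> J" for t
    proof -
      \<comment> \<open>The operator \<open>s * d/ds\<close> multiplies the coefficient of s^n by n.
        The case split on \<open>n\<close> is needed because \<open>fps_X\<close> shifts indices: at
        n = 0 this term vanishes, and at a successor the shift undoes that of
        \<open>fps_deriv\<close>.\<close>
      have "- 3 * a * (real n * fps_nth (f t) n) - 2 * ((b + a * t) * deriv (\<lambda>u. fps_nth (f u) n) t)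
          + a * fps_nth (f t) n = 0"
        using arg_cong[OF eq1[OF that], of "\<lambda>F. fps_nth F n"]
        by (cases n) (simp_all add: fps_dt_def fps_ds_def mult.assoc
            numeral_fps_const neg_numeral_fps_const del: fps_const_mult)
      thus ?thesis
        by (simp add: field_simps)
    qed
  qed (use J pos in auto)
  thus "\<exists>C :: nat \<Rightarrow> real. \<forall>n. \<forall>t\<in>J.
      fps_nth (f t) n = C n * (b + a * t) powr ((1 - 3 * real n) / 2)"
    by metis
next
  fix C :: "nat \<Rightarrow> real"
  let ?K = "a\<^sup>2 * (C 0)\<^sup>2 - a - c"
  assume C: "\<forall>n. \<forall>t\<in>J. fps_nth (f t) n = C n * (b + a * t) powr ((1 - 3 * real n) / 2)"
  assume eq2: "\<forall>t\<in>J.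
      fps_const c + fps_const a - 2 * fps_const a * f t * fps_dt f t
      + 3 * fps_const (b + a * t) * fps_ds f t
      + 4 * fps_const a * fps_X * fps_dt (fps_dt f) t
      - 8 * fps_const a * fps_X * (fps_dt f t) ^ 3
      + 12 * fps_const a * fps_X * fps_dt f t * fps_ds f t = 0"
  \<comment> \<open>The exponent (1 - 3n)/2 is 1/2 at n = 0 and -1 at n = 1, which gives a square
    root here and a reciprocal in \<open>f1\<close>.\<close>
  have f0: "fps_nth (f t) 0 = C 0 * sqrt (b + a * t)" if "t \<in> J" for t
    using C that pos[OF that] by (simp add: powr_half_sqrt)
  have f1: "fps_nth (f t) 1 = C 1 / (b + a * t)" if "t \<in> J" for t
    using C that pos[OF that] by (simp add: powr_minus_divide)
  show C1: "C 1 = ?K / 3"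
  proof -
    \<comment> \<open>Since \<open>C 1\<close> does not depend on the point, evaluating at a single
      point of \<open>J\<close> determines it.\<close>
    obtain t where t: "t \<in> J" using J(3) by blast
    have w: "b + a * t > 0" using pos t .
    have "((\<lambda>u. C 0 * (b + a * u) powr (1/2)) has_real_derivative
        C 0 * (1/2 * a * (b + a * t) powr (1/2 - 1))) (at t)"
      by (rule DERIV_cmult[OF has_real_derivative_affine_powr[OF w]])
    hence "((\<lambda>u. fps_nth (f u) 0) has_real_derivative
        C 0 * (1/2 * a * (b + a * t) powr (1/2 - 1))) (at t)"
      \<comment> \<open>The closed form of f_0 is known on \<open>J\<close> only; as
        \<open>J\<close> is open, it agrees with f_0 near \<open>t\<close>, which suffices for the
        derivative in the real line.\<close>
      by (rule has_field_derivative_transform_within_open[OF _ J(1) t]) (use C in simp)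
    hence "deriv (\<lambda>u. fps_nth (f u) 0) t = C 0 * a / (2 * sqrt (b + a * t))"
      using w by (simp add: DERIV_imp_deriv powr_minus_divide powr_half_sqrt)
    \<comment> \<open>The square root in f_0 cancels the one in the denominator of its
      derivative.\<close>
    hence "2 * a * fps_nth (f t) 0 * deriv (\<lambda>u. fps_nth (f u) 0) t = a\<^sup>2 * (C 0)\<^sup>2"
      using w by (simp add: f0[OF t] power2_eq_square)
    moreover have "c + a - 2 * a * fps_nth (f t) 0 * deriv (\<lambda>u. fps_nth (f u) 0) t
        + 3 * (b + a * t) * fps_nth (f t) 1 = 0"
      using arg_cong[OF eq2[rule_format, OF t], of "\<lambda>F. fps_nth F 0"]
      by (simp add: fps_dt_def fps_ds_def)
    \<comment> \<open>The weight \<open>b + a * t\<close> cancels the reciprocal in f_1, so the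
      relation involves constants only.\<close>
    moreover have "3 * (b + a * t) * fps_nth (f t) 1 = 3 * C 1"
      unfolding f1[OF t] using w by (simp add: field_simps)
    ultimately have "c + a - a\<^sup>2 * (C 0)\<^sup>2 + 3 * C 1 = 0"
      by (simp only:)
    thus ?thesis
      by simp
  qed
  fix t assume t: "t \<in> J"
  have f1': "fps_nth (f t) 1 = ?K / (3 * (b + a * t))"
    unfolding f1[OF t] C1 by (rule divide_divide_eq_left)
  show "fps_nth (fps_ds f t) 0 = ?K / (3 * (b + a * t))"
    using f1' by (simp add: fps_ds_def)
  show "fps_X ^ 2 dvd
      f t - (fps_const (C 0 * sqrt (b + a * t)) + fps_const (?K / (3 * (b + a * t))) * fps_X)"
    by (rule fps_X_power_dvd) (use f0[OF t] f1' in \<open>auto simp: less_2_cases_iff\<close>)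
qed

end
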